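(* Suppose that $q(x|\theta)$ is $MTP_2$, i.e. $q(\cdot|\theta)\le_{lr}q(\cdot|\theta')$ for all $\theta\le\theta'$ in $\Theta$. Then the reservation levels $x_{n,N}^*(i)$, $n=0,\dots,N-1$, are increasing in $i$, i.e. $i\le i'$ in $I$ implies $x_{n,N}^*(i)\le x_{n,N}^*(i')$.
   Context: "Increasing" is meant in the non-strict sense. Bayesian house selling problem. Given the unknown parameter $\theta\in\Theta\subset\mathbb{R}$, the offers $X_0,\dots,X_N$ are independent and identically distributed real random variables with distribution $Q_\theta$ having density $q(x|\theta)$ with respect to a $\sigma$-finite measure $\lambda$ on $\mathbb{R}$; a prior distribution $Q_0$ of $\theta$ is given. It is assumed that $\sup_{\theta}\mathbb{E}_\theta[X_1^+]<\infty$. Here $c>0$ is a constant maintenance cost, $N\in\mathbb{N}$ is the time horizon, and $U:\mathbb{R}\to\mathbb{R}$ is a strictly increasing and concave utility function; $U_n(x):=U(x-nc)$, so $U_n^{-1}(y)=nc+U^{-1}(y)$. The updating operator is $$\Phi(x,\mu)(B)=\frac{\int_B q(x|\theta)\,\mu(d\theta)}{\int_\Theta q(x|\theta)\,\mu(d\theta)},\quad B\in\mathcal{B}(\Theta),$$ for probability measures $\mu$ on $\Theta$. The filter is given by $\mu_0=Q_0$ and $\mu_{n+1}(\cdot|h_n,x')=\Phi(x',\mu_n(\cdot|h_n))$ for histories $h_n=(x_0,\dots,x_n)\in H_n:=\mathbb{R}^{n+1}$. Sufficient statistics. It is assumed that there is a (Borel) information set $I$ endowed with a $\sigma$-algebra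 such that there exist measurable functions $t_n:H_n\to I$ and a transition kernel $\hat\mu$ from $I$ to $\Theta$ with $\mu_n(B|h_n)=\hat\mu(B|t_n(h_n))$ for all $B\in\mathcal{B}(\Theta)$; that there is a measurable map $\hat\Phi:\mathbb{R}\times I\to I$ with $t_{n+1}(h_{n+1})=\hat\Phi(x_{n+1},t_n(h_n))$ for $h_{n+1}=(h_n,x_{n+1})$; and that $\hat\mu(\cdot|i)$ has a density $\hat p(\cdot|i)$. With $Q(B|i):=\int_B\int_\Theta q(x|\theta)\,\hat\mu(d\theta|i)\,\lambda(dx)$, the reservation levels are defined for $i\in I$ by $$x_{N-1,N}^*(i):=U_{N-1}^{-1}\Big(\int_{\mathbb{R}}U_N(x)\,Q(dx|i)\Big),$$ $$x_{n,N}^*(i):=U_n^{-1}\Big(\int_{\mathbb{R}}U_{n+1}\big(\max\{x,x_{n+1,N}^*(\hat\Phi(x,i))\}\big)\,Q(dx|i)\Big),\quad n=0,\dots,N-2.$$ Order on $I$: for $i,i'\in I$, $i\le i'$ if and only if $\hat\mu(\cdot|i)\le_{lr}\hat\mu(\cdot|i')$, where $\le_{lr}$ is the likelihood ratio ordering, i.e. if and only if $\hat p(\theta|i')/\hat p(\theta|i)$ is increasing in $\theta$. Likewise, $q(\cdot|\theta)\le_{lr}q(\cdot|\theta')$ means that $q(x|\theta')/q(x|\theta)$ is increasing in $x$.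
   Formalization: It is additionally assumed that μ̂(·|Φ̂(x,i)) = Φ(x, μ̂(·|i)) for every i in I and every x with well-defined posterior, not only for attained i = t_n(h_n); without this, Φ̂ is arbitrary at unattained points and the claim fails. *)

theory Defs
  imports "HOL-Probability.Probability"
begin

text \<open>
  Throughout, \<open>q x \<theta>\<close> stands for $q(x|\theta)$ and \<open>p \<theta> i\<close> for $\hat p(\theta|i)$, both real-valued.
  Laws on the parameter set live on \<open>restrict_space borel \<Theta>\<close>, the trace of the Borel sets.
\<close>

text \<open>
  Likelihood ratio order of two densities \<open>f\<close>, \<open>g\<close> on \<open>S\<close>: the ratio \<open>g / f\<close> is increasing.
  As usual, the ratio is considered where at least one of the densities is positive, and it is
  \<open>\<infinity>\<close> where only \<open>f\<close> vanishes; this is what division in \<open>ennreal\<close> gives.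
\<close>

definition lr_le :: "real set \<Rightarrow> (real \<Rightarrow> real) \<Rightarrow> (real \<Rightarrow> real) \<Rightarrow> bool" where
  "lr_le S f g \<longleftrightarrow>
     mono_on {x \<in> S. 0 < f x \<or> 0 < g x} (\<lambda>x. ennreal (g x) / ennreal (f x))"

definition mtp2 :: "real set \<Rightarrow> (real \<Rightarrow> real \<Rightarrow> real) \<Rightarrow> bool" where
  "mtp2 \<Theta> q \<longleftrightarrow>
     (\<forall>\<theta>\<in>\<Theta>. \<forall>\<theta>'\<in>\<Theta>. \<theta> \<le> \<theta>' \<longrightarrow> lr_le UNIV (\<lambda>x. q x \<theta>) (\<lambda>x. q x \<theta>'))"

definition info_le :: "real set \<Rightarrow> (real \<Rightarrow> 'i \<Rightarrow> real) \<Rightarrow> 'i \<Rightarrow> 'i \<Rightarrow> bool" where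
  "info_le \<Theta> p i i' \<longleftrightarrow> lr_le \<Theta> (\<lambda>\<theta>. p \<theta> i) (\<lambda>\<theta>. p \<theta> i')"

definition offer_law :: "real measure \<Rightarrow> (real \<Rightarrow> real \<Rightarrow> real) \<Rightarrow> real \<Rightarrow> real measure" where
  "offer_law lam q \<theta> = density lam (\<lambda>x. ennreal (q x \<theta>))"

text \<open>
  The updating operator $\Phi(x,\mu)$. If the normalising integral is \<open>0\<close> or \<open>\<infinity>\<close>, the
  quotient defining the posterior is meaningless; the term below is then the null measure.
  Hence, for a probability measure \<open>\<mu>\<close>, \<open>bayes_update q x \<mu>\<close> is a probability measure
  exactly if the posterior is well defined, and likewise for \<open>bayes_filter\<close>.
\<close>

definition bayes_update :: "(real \<Rightarrow> real \<Rightarrow> real) \<Rightarrow> real \<Rightarrow> real measure \<Rightarrow> real measure" where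
  "bayes_update q x \<mu> =
     density \<mu> (\<lambda>\<theta>. ennreal (q x \<theta>) / (\<integral>\<^sup>+ \<theta>'. ennreal (q x \<theta>') \<partial>\<mu>))"

text \<open>
  A history $h_n = (x_0,\dots,x_n)$ is a function on \<open>{..n}\<close>. The first offer $x_0$
  does not enter the filter, since $\mu_0(\cdot|h_0)$ is the prior.
\<close>

definition history :: "nat \<Rightarrow> (nat \<Rightarrow> real) measure" where
  "history n = (\<Pi>\<^sub>M k\<in>{..n}. borel)"

primrec bayes_filter ::
    "(real \<Rightarrow> real \<Rightarrow> real) \<Rightarrow> real measure \<Rightarrow> nat \<Rightarrow> (nat \<Rightarrow> real) \<Rightarrow> real measure" where
  "bayes_filter q Q0 0 h = Q0"
| "bayes_filter q Q0 (Suc n) h = bayes_update q (h (Suc n)) (bayes_filter q Q0 n h)"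

text \<open>\<open>predictive lam q (\<mu>h i)\<close> is $Q(\cdot|i)$.\<close>

definition predictive ::
    "real measure \<Rightarrow> (real \<Rightarrow> real \<Rightarrow> real) \<Rightarrow> real measure \<Rightarrow> real measure" where
  "predictive lam q \<mu> = density lam (\<lambda>x. \<integral>\<^sup>+ \<theta>. ennreal (q x \<theta>) \<partial>\<mu>)"

text \<open>
  The hypotheses on the offers bound the positive part of every utility integral but not its
  negative part, so these integrals take values in $[-\infty,\infty)$. They are therefore
  formed as difference of positive and negative part, and $U^{-1}(-\infty) = -\infty$.
  For integrable \<open>f\<close> the value is the ordinary integral.
\<close>

definition ext_integral :: "real measure \<Rightarrow> (real \<Rightarrow> real) \<Rightarrow> ereal" where
  "ext_integral M f =
     enn2ereal (\<integral>\<^sup>+ x. ennreal (f x) \<partial>M) - enn2ereal (\<integral>\<^sup>+ x. ennreal (- f x) \<partial>M)"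

definition util :: "(real \<Rightarrow> real) \<Rightarrow> real \<Rightarrow> nat \<Rightarrow> real \<Rightarrow> real" where
  "util U c n x = U (x - real n * c)"

definition util_inv :: "(real \<Rightarrow> real) \<Rightarrow> real \<Rightarrow> nat \<Rightarrow> ereal \<Rightarrow> ereal" where
  "util_inv U c n y =
     (case y of ereal r \<Rightarrow> ereal (real n * c + inv U r) | PInfty \<Rightarrow> \<infinity> | MInfty \<Rightarrow> -\<infinity>)"

text \<open>
  \<open>reservation U c N Q \<Phi>h n i\<close> is $x^*_{n,N}(i)$; only \<open>n < N\<close> is meaningful. Levels are
  always \<open>< \<infinity>\<close> in the model, so the maximum of a level and an offer \<open>x\<close> is a real number.
\<close>

function reservation ::
    "(real \<Rightarrow> real) \<Rightarrow> real \<Rightarrow> nat \<Rightarrow> ('i \<Rightarrow> real measure) \<Rightarrow> (real \<Rightarrow> 'i \<Rightarrow> 'i) \<Rightarrow> nat \<Rightarrow> 'i \<Rightarrow> ereal"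
  where
  "reservation U c N Q \<Phi>h n i =
     (if Suc n < N
      then util_inv U c n (ext_integral (Q i) (\<lambda>x.
             util U c (Suc n)
               (real_of_ereal (max (ereal x) (reservation U c N Q \<Phi>h (Suc n) (\<Phi>h x i))))))
      else util_inv U c (N - 1) (ext_integral (Q i) (util U c N)))"
  by pat_completeness auto
termination
  by (relation "Wellfounded.measure (\<lambda>(U, c, N, Q, \<Phi>h, n, i). N - n)") auto

declare reservation.simps [simp del]

end

theory Submission
  imports Defs
begin

text \<open>
  A higher state of information says two things in the likelihood ratio order: offers will be
  larger, and every further offer leads to a higher posterior. Both come from one symmetrised
  double integral, \<open>basic_composition\<close>, applied to the inequality
  $f(t)\,g(s) \le f(s)\,g(t)$ for $s \le t$, which is the likelihood ratio order with the
  denominators cleared (\<open>cross_le\<close>). In this form the order survives pointwise multiplication, so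
  it passes from $\hat\mu(\cdot|i) \le_{lr} \hat\mu(\cdot|i')$ to the posteriors after
  offers $x \le x'$, whose densities are proportional to $q(x|\theta)\,\hat p(\theta|i)$ and
  $q(x'|\theta)\,\hat p(\theta|i')$ (\<open>posterior_le_update\<close>). Integrating out $\theta$ with
  \<open>basic_composition\<close> gives $Q(\cdot|i) \le_{lr} Q(\cdot|i')$ (\<open>marginal_cross_le\<close>),
  and integrating increasing functions with it turns this into stochastic dominance.

  The theorem follows by backward induction on $n$ (\<open>level_mono\<close>). If the levels at time $n+1$
  are increasing, then what can be secured at time $n+1$, namely
  $\max\{x, x^*_{n+1,N}(\hat\Phi(x,i))\}$, is increasing jointly in $x$ and $i$, so the
  expected utility is increasing in $i$.

  Two points need care. First, $\hat\Phi(x,i)$ carries a meaningful posterior only for offers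
  $x$ that are possible under $i$, and these need not be the offers that are possible under
  $i'$. The two payoffs are therefore compared at pairs of offers: the dominance lemmas ask
  for $F(x) \le G(y)$ only for $x \le y$ with $x$ possible under $i$ and $y$ possible under
  $i'$. An increasing function can be inserted between two such $F$ and $G$, and it is this
  function that is integrated. Second, \<open>inv U\<close> is increasing only on
  the range of \<open>U\<close>, and \<open>real_of_ereal\<close> only on finite values. Supporting lines of the concave
  function \<open>U\<close> bound every expected utility by some \<open>U m\<close> with \<open>m\<close> uniform in the
  information (\<open>expected_utility_bounded\<close>), and every real number below \<open>U m\<close> is a value
  of \<open>U\<close>.
\<close>

section \<open>The likelihood ratio order in product form\<close>

text \<open>
  Compared with the ratio form, there are no quotients \<open>0 / 0\<close> to be excluded, which is what
  makes the relation stable under products and integration.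
\<close>

definition cross_le :: "'a::linorder set \<Rightarrow> ('a \<Rightarrow> ennreal) \<Rightarrow> ('a \<Rightarrow> ennreal) \<Rightarrow> bool" where
  "cross_le S f g \<longleftrightarrow> (\<forall>s\<in>S. \<forall>t\<in>S. s \<le> t \<longrightarrow> f t * g s \<le> f s * g t)"

lemma cross_leI:
  "(\<And>s t. s \<in> S \<Longrightarrow> t \<in> S \<Longrightarrow> s \<le> t \<Longrightarrow> f t * g s \<le> f s * g t) \<Longrightarrow> cross_le S f g"
  by (simp add: cross_le_def)

lemma cross_leD:
  "cross_le S f g \<Longrightarrow> s \<in> S \<Longrightarrow> t \<in> S \<Longrightarrow> s \<le> t \<Longrightarrow> f t * g s \<le> f s * g t"
  by (simp add: cross_le_def)

lemma lr_le_imp_cross_le: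
  assumes lr: "lr_le S f g"
    and f: "\<And>x. x \<in> S \<Longrightarrow> 0 \<le> f x" and g: "\<And>x. x \<in> S \<Longrightarrow> 0 \<le> g x"
  shows "cross_le S (\<lambda>x. ennreal (f x)) (\<lambda>x. ennreal (g x))"
proof (rule cross_leI)
  fix s t assume st: "s \<in> S" "t \<in> S" "s \<le> t"
  show "ennreal (f t) * ennreal (g s) \<le> ennreal (f s) * ennreal (g t)"
  proof (cases "f t = 0 \<or> g s = 0")
    case True
    then show ?thesis by auto
  next
    case False
    then have pos: "0 < f t" "0 < g s" using f g st by (auto simp: less_le)
    have ratio: "ennreal (g s) / ennreal (f s) \<le> ennreal (g t) / ennreal (f t)"
      using lr pos st unfolding lr_le_def by (auto elim!: mono_onD)
    have "f s \<noteq> 0"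
    proof
      assume "f s = 0"
      then have "ennreal (g s) / ennreal (f s) = top"
        using pos by (simp add: ennreal_divide_self ennreal_divide_eq_top_iff)
      then show False
        using ratio pos g[OF st(2)] by (simp add: divide_ennreal top_unique)
    qed
    then have "0 < f s" using f st by (auto simp: less_le)
    then show ?thesis
      using ratio pos f st g[OF st(2)]
      by (simp add: divide_ennreal ennreal_mult[symmetric] field_simps)
  qed
qed

lemma cross_le_mult:
  assumes "cross_le S f g" "cross_le S k l"
  shows "cross_le S (\<lambda>x. f x * k x) (\<lambda>x. g x * l x)"
proof (rule cross_leI)
  fix s t assume "s \<in> S" "t \<in> S" "s \<le> t"
  then have "(f t * g s) * (k t * l s) \<le> (f s * g t) * (k s * l t)"
    using assms by (intro mult_mono cross_leD) auto
  then show "f t * k t * (g s * l s) \<le> f s * k s * (g t * l t)"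
    by (simp add: mult_ac)
qed

lemma cross_le_const: "cross_le S (\<lambda>_. a) (\<lambda>_. b)"
  by (simp add: cross_le_def)

text \<open>
  Written with \<open>A = B + e\<close> and \<open>a = b + e'\<close>, the two sides differ by \<open>e * e'\<close>; subtraction,
  which behaves badly in \<open>ennreal\<close>, is avoided.
\<close>

lemma rearrangement_ennreal:
  fixes A B a b :: ennreal
  assumes "B \<le> A" "b \<le> a"
  shows "B * a + A * b \<le> A * a + B * b"
proof -
  obtain e e' where "A = B + e" "a = b + e'"
    using assms by (auto simp: le_iff_add)
  then show ?thesis
    by (auto simp: algebra_simps intro!: add_left_mono add_increasing2)
qed

text \<open>
  The basic composition formula of total positivity. Each product of two integrals, added to itself
  with the factors exchanged, is one double integral in \<open>s\<close> and \<open>t\<close>. At every pair the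
  integrands are compared by the rearrangement inequality, since for \<open>s \<le> t\<close> both
  \<open>f s * g t\<close> and \<open>k s * l t\<close> dominate their counterparts with \<open>s\<close> and \<open>t\<close> exchanged.
\<close>

lemma basic_composition:
  fixes M :: "'a::linorder measure"
  assumes [measurable]: "f \<in> borel_measurable M" "g \<in> borel_measurable M"
      "k \<in> borel_measurable M" "l \<in> borel_measurable M"
    and fg: "cross_le (space M) f g" and kl: "cross_le (space M) k l"
  shows "(\<integral>\<^sup>+x. l x * f x \<partial>M) * (\<integral>\<^sup>+x. k x * g x \<partial>M)
      \<le> (\<integral>\<^sup>+x. k x * f x \<partial>M) * (\<integral>\<^sup>+x. l x * g x \<partial>M)"
    (is "?lf * ?kg \<le> ?kf * ?lg")
proof -
  have double: "(\<integral>\<^sup>+x. u x \<partial>M) * (\<integral>\<^sup>+x. v x \<partial>M) + (\<integral>\<^sup>+x. v x \<partial>M) * (\<integral>\<^sup>+x. u x \<partial>M)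
      = (\<integral>\<^sup>+s. \<integral>\<^sup>+t. u s * v t + v s * u t \<partial>M \<partial>M)"
    if [measurable]: "u \<in> borel_measurable M" "v \<in> borel_measurable M" for u v :: "'a \<Rightarrow> ennreal"
    by (simp add: nn_integral_add nn_integral_cmult nn_integral_multc)
  have le: "l s * f s * (k t * g t) + k s * g s * (l t * f t)
      \<le> k s * f s * (l t * g t) + l s * g s * (k t * f t)"
    if "s \<in> space M" "t \<in> space M" for s t
  proof (cases "s \<le> t")
    case True
    have "k t * l s * (f s * g t) + k s * l t * (f t * g s)
        \<le> k s * l t * (f s * g t) + k t * l s * (f t * g s)"
      using that True fg kl by (intro rearrangement_ennreal cross_leD) auto
    then show ?thesis by (simp add: mult_ac)
  next
    case False
    have "k s * l t * (f t * g s) + k t * l s * (f s * g t)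
        \<le> k t * l s * (f t * g s) + k s * l t * (f s * g t)"
      using that False fg kl by (intro rearrangement_ennreal cross_leD) auto
    then show ?thesis by (simp add: mult_ac add_ac)
  qed
  have "?lf * ?kg + ?kg * ?lf \<le> ?kf * ?lg + ?lg * ?kf"
    unfolding double[of "\<lambda>x. l x * f x" "\<lambda>x. k x * g x", simplified]
      double[of "\<lambda>x. k x * f x" "\<lambda>x. l x * g x", simplified]
    by (intro nn_integral_mono le)
  then have "2 * (?lf * ?kg) \<le> 2 * (?kf * ?lg)"
    by (simp only: mult_2 mult.commute[of ?kg] mult.commute[of ?lg])
  then show ?thesis
    by (subst (asm) ennreal_mult_le_mult_iff) auto
qed

section \<open>Stochastic dominance\<close>

lemma borel_measurable_mono_ennreal:
  fixes h :: "real \<Rightarrow> ennreal"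
  assumes "mono h \<or> antimono h"
  shows "h \<in> borel_measurable borel"
proof (rule borel_measurableI_greater)
  fix a
  have "is_interval {x. a < h x}"
    using assms unfolding is_interval_1
    by (auto dest: monoD antimonoD intro: less_le_trans)
  then show "{x \<in> space borel. a < h x} \<in> sets borel"
    by (simp add: real_interval_borel_measurable)
qed

text \<open>
  The function \<open>h\<close> below is increasing and fits between \<open>F\<close> on \<open>D\<close> and \<open>G\<close> on \<open>D'\<close>. For
  it, \<open>basic_composition\<close> with the constant \<open>1\<close> and \<open>h\<close> as second pair compares the two
  integrals. Monotonicity makes \<open>h\<close> measurable, even where \<open>F\<close> and \<open>G\<close> are not.
\<close>

lemma nn_integral_mono_cross_le:
  fixes M :: "real measure"
  assumes sets: "sets M = sets borel"
    and [measurable]: "f \<in> borel_measurable M" "g \<in> borel_measurable M"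
    and P: "prob_space (density M f)" "prob_space (density M g)"
    and fg: "cross_le UNIV f g"
    and D: "AE x in density M f. x \<in> D" and D': "AE x in density M g. x \<in> D'"
    and FG: "\<And>x y. x \<in> D \<Longrightarrow> y \<in> D' \<Longrightarrow> x \<le> y \<Longrightarrow> F x \<le> (G y :: ennreal)"
  shows "(\<integral>\<^sup>+x. F x \<partial>density M f) \<le> (\<integral>\<^sup>+x. G x \<partial>density M g)"
proof -
  have one: "(\<integral>\<^sup>+x. f x \<partial>M) = 1" "(\<integral>\<^sup>+x. g x \<partial>M) = 1"
    using P[THEN prob_space.emeasure_space_1] by (auto simp: emeasure_density cong: nn_integral_cong)
  define h where "h x = (SUP y\<in>{y\<in>D. y \<le> x}. F y)" for x
  have "mono h"
    unfolding h_def by (intro monoI SUP_subset_mono) auto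
  then have [measurable]: "h \<in> borel_measurable M"
    using borel_measurable_mono_ennreal[of h] sets by (simp cong: measurable_cong_sets)
  have "(\<integral>\<^sup>+x. F x \<partial>density M f) \<le> (\<integral>\<^sup>+x. h x \<partial>density M f)"
    using D by (intro nn_integral_mono_AE) (auto simp: h_def intro!: SUP_upper)
  also have "\<dots> \<le> (\<integral>\<^sup>+x. h x \<partial>density M g)"
    using basic_composition[of f M g "\<lambda>_. 1" h] fg one \<open>mono h\<close> sets_eq_imp_space_eq[OF sets]
    by (simp add: nn_integral_density mult.commute cross_le_def monoD)
  also have "\<dots> \<le> (\<integral>\<^sup>+x. G x \<partial>density M g)"
    using D' by (intro nn_integral_mono_AE) (auto simp: h_def intro!: SUP_least FG)
  finally show ?thesis .
qed

text \<open>
  The mirror image, needed for the negative parts of utilities: now a decreasing \<open>h\<close> is inserted,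
  and the pair \<open>h\<close>, \<open>1\<close> is the one in product order.
\<close>

lemma nn_integral_antimono_cross_le:
  fixes M :: "real measure"
  assumes sets: "sets M = sets borel"
    and [measurable]: "f \<in> borel_measurable M" "g \<in> borel_measurable M"
    and P: "prob_space (density M f)" "prob_space (density M g)"
    and fg: "cross_le UNIV f g"
    and D: "AE x in density M f. x \<in> D" and D': "AE x in density M g. x \<in> D'"
    and FG: "\<And>x y. x \<in> D \<Longrightarrow> y \<in> D' \<Longrightarrow> x \<le> y \<Longrightarrow> G y \<le> (F x :: ennreal)"
  shows "(\<integral>\<^sup>+x. G x \<partial>density M g) \<le> (\<integral>\<^sup>+x. F x \<partial>density M f)"
proof -
  have one: "(\<integral>\<^sup>+x. f x \<partial>M) = 1" "(\<integral>\<^sup>+x. g x \<partial>M) = 1"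
    using P[THEN prob_space.emeasure_space_1] by (auto simp: emeasure_density cong: nn_integral_cong)
  define h where "h x = (INF y\<in>{y\<in>D. y \<le> x}. F y)" for x
  have "antimono h"
    unfolding h_def by (intro antimonoI INF_superset_mono) auto
  then have [measurable]: "h \<in> borel_measurable M"
    using borel_measurable_mono_ennreal[of h] sets by (simp cong: measurable_cong_sets)
  have "(\<integral>\<^sup>+x. G x \<partial>density M g) \<le> (\<integral>\<^sup>+x. h x \<partial>density M g)"
    using D' by (intro nn_integral_mono_AE) (auto simp: h_def intro!: INF_greatest FG)
  also have "\<dots> \<le> (\<integral>\<^sup>+x. h x \<partial>density M f)"
    using basic_composition[of f M g h "\<lambda>_. 1"] fg one \<open>antimono h\<close> sets_eq_imp_space_eq[OF sets]
    by (simp add: nn_integral_density mult.commute cross_le_def antimonoD)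
  also have "\<dots> \<le> (\<integral>\<^sup>+x. F x \<partial>density M f)"
    using D by (intro nn_integral_mono_AE) (auto simp: h_def intro!: INF_lower)
  finally show ?thesis .
qed

lemma ext_integral_mono_cross_le:
  fixes M :: "real measure"
  assumes "sets M = sets borel"
    and "f \<in> borel_measurable M" "g \<in> borel_measurable M"
    and "prob_space (density M f)" "prob_space (density M g)"
    and "cross_le UNIV f g"
    and "AE x in density M f. x \<in> D" and "AE x in density M g. x \<in> D'"
    and FG: "\<And>x y. x \<in> D \<Longrightarrow> y \<in> D' \<Longrightarrow> x \<le> y \<Longrightarrow> F x \<le> G y"
  shows "ext_integral (density M f) F \<le> ext_integral (density M g) G"
proof -
  have "(\<integral>\<^sup>+x. ennreal (F x) \<partial>density M f) \<le> (\<integral>\<^sup>+x. ennreal (G x) \<partial>density M g)"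
    by (rule nn_integral_mono_cross_le[OF assms(1-8)]) (auto intro!: ennreal_leI FG)
  moreover have "(\<integral>\<^sup>+x. ennreal (- G x) \<partial>density M g) \<le> (\<integral>\<^sup>+x. ennreal (- F x) \<partial>density M f)"
    by (rule nn_integral_antimono_cross_le[OF assms(1-8)]) (auto intro!: ennreal_leI FG)
  ultimately show ?thesis
    unfolding ext_integral_def by (intro ereal_minus_mono) (simp_all add: less_eq_ennreal.rep_eq)
qed

lemma ext_integral_mono_AE:
  assumes "AE x in M. F x \<le> G x"
  shows "ext_integral M F \<le> ext_integral M G"
proof -
  have "(\<integral>\<^sup>+x. ennreal (F x) \<partial>M) \<le> (\<integral>\<^sup>+x. ennreal (G x) \<partial>M)"
    using assms by (intro nn_integral_mono_AE) (auto intro: ennreal_leI)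
  moreover have "(\<integral>\<^sup>+x. ennreal (- G x) \<partial>M) \<le> (\<integral>\<^sup>+x. ennreal (- F x) \<partial>M)"
    using assms by (intro nn_integral_mono_AE) (auto intro!: ennreal_leI)
  ultimately show ?thesis
    unfolding ext_integral_def by (intro ereal_minus_mono) (simp_all add: less_eq_ennreal.rep_eq)
qed

lemma ext_integral_eq_integral:
  assumes "integrable M f"
  shows "ext_integral M f = ereal (integral\<^sup>L M f)"
proof -
  have "(\<integral>\<^sup>+x. ennreal (f x) \<partial>M) \<noteq> \<infinity>" "(\<integral>\<^sup>+x. ennreal (- f x) \<partial>M) \<noteq> \<infinity>"
    using assms by (auto simp: real_integrable_def)
  then show ?thesis
    unfolding ext_integral_def real_lebesgue_integral_def[OF assms]
    by (cases "\<integral>\<^sup>+x. ennreal (f x) \<partial>M"; cases "\<integral>\<^sup>+x. ennreal (- f x) \<partial>M")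
      (auto simp: enn2real_def)
qed

section \<open>Concave utilities\<close>

lemma concave_strict_mono_supporting_line:
  fixes U :: "real \<Rightarrow> real"
  assumes "strict_mono U" "concave_on UNIV U"
  obtains b where "0 < b" "\<And>y. U y \<le> U m + b * (y - m)"
proof -
  have cvx: "convex_on UNIV (\<lambda>x. - U x)"
    using assms(2) by (simp add: concave_on_def)
  define a where "a = Inf ((\<lambda>t. (- U m - - U t) / (m - t)) ` ({m<..} \<inter> UNIV))"
  have line: "U y \<le> U m + (- a) * (y - m)" for y
    using convex_le_Inf_differential[OF cvx, of m y] by (simp add: a_def algebra_simps)
  have "U m < U (m + 1)"
    using assms(1) by (simp add: strict_mono_def)
  with line[of "m + 1"] have "0 < - a" by simp
  then show ?thesis using line by (rule that)
qed

text \<open>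
  A supporting line has positive slope, so \<open>U\<close> tends to \<open>-\<infinity>\<close> at \<open>-\<infinity>\<close>; being continuous,
  it takes every value below one of its values. It may still be bounded above.
\<close>

lemma concave_strict_mono_attains_below:
  fixes U :: "real \<Rightarrow> real"
  assumes U: "strict_mono U" "concave_on UNIV U" and r: "r \<le> U m"
  obtains z where "z \<le> m" "U z = r"
proof -
  obtain b where b: "0 < b" "\<And>y. U y \<le> U m + b * (y - m)"
    using concave_strict_mono_supporting_line[OF U, of m] by blast
  \<comment> \<open>\<open>l\<close> is the point where the supporting line at \<open>m\<close> takes the value \<open>r\<close>.\<close>
  define l where "l = m - (U m - r) / b"
  have "l \<le> m" using b r by (simp add: l_def)
  have "U l \<le> r" using b(2)[of l] b(1) by (simp add: l_def)
  have "continuous_on UNIV (\<lambda>x. - U x)"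
    using U(2) by (intro convex_on_continuous) (auto simp: concave_on_def)
  then have "continuous_on UNIV (\<lambda>x. - (- U x))"
    by (rule continuous_on_minus)
  then have "continuous_on {l..m} U"
    by (auto intro: continuous_on_subset)
  then obtain z where "l \<le> z" "z \<le> m" "U z = r"
    using IVT'[of U l r m] \<open>U l \<le> r\<close> r \<open>l \<le> m\<close> by auto
  then show ?thesis by (intro that)
qed

text \<open>
  The bound \<open>U m\<close> keeps the finite arguments in the range of \<open>U\<close>, where \<open>inv U\<close> is a genuine
  inverse, and excludes the argument \<open>\<infinity>\<close>.
\<close>

lemma util_inv_mono_bounded:
  assumes U: "strict_mono U" "concave_on UNIV U" and y: "y \<le> y'" "y' \<le> ereal (U m)"
  shows "util_inv U c n y \<le> util_inv U c n y'"
    and "util_inv U c n y' \<le> ereal (real n * c + m)"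
proof -
  have inv: "inv U (U z) = z" for z
    using U(1) by (simp add: strict_mono_imp_inj_on)
  note below = concave_strict_mono_attains_below[OF U]
  show "util_inv U c n y' \<le> ereal (real n * c + m)"
  proof (cases y')
    case (real r)
    with y obtain z where "z \<le> m" "U z = r" using below[of r m] by auto
    with real inv show ?thesis by (auto simp: util_inv_def)
  qed (use y in \<open>auto simp: util_inv_def\<close>)
  show "util_inv U c n y \<le> util_inv U c n y'"
  proof (cases "y = -\<infinity>")
    case False
    with y obtain r r' where r: "y = ereal r" "y' = ereal r'" 
      by (cases y; cases y') auto
    with y have le: "r \<le> U m" "r' \<le> U m" by auto
    obtain z where z: "U z = r" using below[OF le(1)] by blast
    obtain z' where z': "U z' = r'" using below[OF le(2)] by blast
    have "U z \<le> U z'" using y r z z' by simp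
    then have "z \<le> z'" by (simp only: strict_mono_less_eq[OF U(1)])
    with r z z' inv[of z] inv[of z'] show ?thesis by (simp add: util_inv_def)
  qed (simp add: util_inv_def)
qed


text \<open>
  Jensen's inequality, obtained by integrating the supporting line at \<open>C + B\<close>. The line composed
  with \<open>F\<close> is dominated by the integrable function \<open>L\<close>.
\<close>

lemma ext_integral_concave_le:
  fixes U :: "real \<Rightarrow> real"
  assumes U: "strict_mono U" "concave_on UNIV U"
    and M: "prob_space M" "sets M = sets borel"
    and C: "(\<integral>\<^sup>+x. ennreal (max 0 x) \<partial>M) \<le> ennreal C" "0 \<le> C"
    and F: "\<And>x. F x \<le> max 0 x + B"
  shows "ext_integral M (\<lambda>x. U (F x)) \<le> ereal (U (C + B))"
proof -
  interpret prob_space M by fact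
  obtain b where b: "0 < b" "\<And>y. U y \<le> U (C + B) + b * (y - (C + B))"
    using concave_strict_mono_supporting_line[OF U, of "C + B"] by blast
  define L where "L x = U (C + B) + b * (max 0 x - C)" for x
  have [measurable]: "(\<lambda>x. max 0 x) \<in> borel_measurable M"
    using M(2) by (simp cong: measurable_cong_sets)
  have int: "integrable M (\<lambda>x. max 0 x)"
    using C(1) by (intro integrableI_nonneg) (auto simp: le_less_trans)
  then have mean: "(\<integral>x. max 0 x \<partial>M) \<le> C"
    using C by (subst integral_eq_nn_integral) (auto intro: enn2real_leI)
  have le: "U (F x) \<le> L x" for x
  proof -
    have "b * (F x - (C + B)) \<le> b * (max 0 x - C)"
      using b(1) F[of x] by (intro mult_left_mono) auto
    then show ?thesis
      using b(2)[of "F x"] by (simp add: L_def)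
  qed
  have "ext_integral M (\<lambda>x. U (F x)) \<le> ext_integral M L"
    by (intro ext_integral_mono_AE) (simp add: le)
  also have "\<dots> = ereal (U (C + B) + b * ((\<integral>x. max 0 x \<partial>M) - C))"
    unfolding L_def using int by (subst ext_integral_eq_integral) (auto simp: prob_space)
  also have "\<dots> \<le> ereal (U (C + B))"
    using b(1) mean by (simp add: mult_nonneg_nonpos)
  finally show ?thesis .
qed

section \<open>Offers, predictive laws and posteriors\<close>

locale offer_model =
  fixes \<Theta> :: "real set" and lam :: "real measure" and q :: "real \<Rightarrow> real \<Rightarrow> real"
  assumes sigma_finite_lam: "sigma_finite_measure lam" and sets_lam: "sets lam = sets borel"
    and q_measurable:
      "(\<lambda>(x, \<theta>). q x \<theta>) \<in> borel_measurable (borel \<Otimes>\<^sub>M restrict_space borel \<Theta>)"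
    and q_nonneg: "\<And>x \<theta>. \<theta> \<in> \<Theta> \<Longrightarrow> 0 \<le> q x \<theta>"
    and q_density: "\<And>\<theta>. \<theta> \<in> \<Theta> \<Longrightarrow> prob_space (offer_law lam q \<theta>)"
    and offers_bounded:
      "(SUP \<theta>\<in>\<Theta>. \<integral>\<^sup>+ x. ennreal (max 0 x) \<partial>offer_law lam q \<theta>) < \<infinity>"
    and mtp2: "mtp2 \<Theta> q"
begin

abbreviation law :: "real measure \<Rightarrow> bool" where
  "law \<mu> \<equiv> \<mu> \<in> space (prob_algebra (restrict_space borel \<Theta>))"

definition marginal :: "real measure \<Rightarrow> real \<Rightarrow> ennreal" where
  "marginal \<mu> x = (\<integral>\<^sup>+\<theta>. ennreal (q x \<theta>) \<partial>\<mu>)"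

lemma predictive_eq: "predictive lam q \<mu> = density lam (marginal \<mu>)"
  by (simp add: predictive_def marginal_def[abs_def])

lemma space_lam: "space lam = UNIV"
  using sets_eq_imp_space_eq[OF sets_lam] by simp

lemma space_parameter:
  "sets \<mu> = sets (restrict_space borel \<Theta>) \<Longrightarrow> space \<mu> = \<Theta>"
  by (drule sets_eq_imp_space_eq) (simp add: space_restrict_space)

lemma q_measurable_pair:
  assumes "sets \<mu> = sets (restrict_space borel \<Theta>)"
  shows "(\<lambda>(x, \<theta>). ennreal (q x \<theta>)) \<in> borel_measurable (lam \<Otimes>\<^sub>M \<mu>)"
proof -
  have "(\<lambda>z. ennreal (case z of (x, \<theta>) \<Rightarrow> q x \<theta>))
      \<in> borel_measurable (borel \<Otimes>\<^sub>M restrict_space borel \<Theta>)"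
    using q_measurable by simp
  also have "(\<lambda>z. ennreal (case z of (x, \<theta>) \<Rightarrow> q x \<theta>)) = (\<lambda>(x, \<theta>). ennreal (q x \<theta>))"
    by auto
  also have "borel_measurable (borel \<Otimes>\<^sub>M restrict_space borel \<Theta>) = borel_measurable (lam \<Otimes>\<^sub>M \<mu>)"
    using assms sets_lam by (intro measurable_cong_sets sets_pair_measure_cong) auto
  finally show ?thesis .
qed

lemma q_measurable_parameter:
  assumes "sets \<mu> = sets (restrict_space borel \<Theta>)"
  shows "(\<lambda>\<theta>. ennreal (q x \<theta>)) \<in> borel_measurable \<mu>"
  using measurable_compose_Pair1[OF _ q_measurable_pair[OF assms], of x] space_lam by simp

lemma q_measurable_offer:
  assumes "\<theta> \<in> \<Theta>"
  shows "(\<lambda>x. ennreal (q x \<theta>)) \<in> borel_measurable lam"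
  using measurable_Pair1[OF q_measurable_pair[OF refl], of \<theta>] assms space_parameter[OF refl]
  by simp

lemma lawD:
  assumes "law \<mu>"
  shows "prob_space \<mu>" "sets \<mu> = sets (restrict_space borel \<Theta>)" "space \<mu> = \<Theta>"
  using assms space_parameter[of \<mu>] by (auto simp: space_prob_algebra)

lemma marginal_measurable:
  assumes "law \<mu>"
  shows "marginal \<mu> \<in> borel_measurable lam"
proof -
  interpret prob_space \<mu> using lawD[OF assms] by simp
  show ?thesis
    unfolding marginal_def[abs_def]
    by (rule borel_measurable_nn_integral[OF q_measurable_pair[OF lawD(2)[OF assms]]])
qed

lemma nn_integral_predictive:
  assumes \<mu>: "law \<mu>" and h: "h \<in> borel_measurable borel"
  shows "(\<integral>\<^sup>+x. h x \<partial>predictive lam q \<mu>) = (\<integral>\<^sup>+\<theta>. \<integral>\<^sup>+x. h x \<partial>offer_law lam q \<theta> \<partial>\<mu>)"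
proof -
  interpret prob_space \<mu> using lawD[OF \<mu>] by simp
  interpret lam: sigma_finite_measure lam by (rule sigma_finite_lam)
  interpret pair_sigma_finite lam \<mu> ..
  note [measurable] = marginal_measurable[OF \<mu>] q_measurable_pair[OF lawD(2)[OF \<mu>]]
    q_measurable_parameter[OF lawD(2)[OF \<mu>]]
  have [measurable]: "h \<in> borel_measurable lam"
    using h sets_lam by (simp cong: measurable_cong_sets)
  have "(\<integral>\<^sup>+x. h x \<partial>predictive lam q \<mu>) = (\<integral>\<^sup>+x. \<integral>\<^sup>+\<theta>. ennreal (q x \<theta>) * h x \<partial>\<mu> \<partial>lam)"
    by (simp add: predictive_eq nn_integral_density nn_integral_multc marginal_def)
  also have "\<dots> = (\<integral>\<^sup>+\<theta>. \<integral>\<^sup>+x. ennreal (q x \<theta>) * h x \<partial>lam \<partial>\<mu>)"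
    by (rule Fubini'[symmetric]) measurable
  also have "\<dots> = (\<integral>\<^sup>+\<theta>. \<integral>\<^sup>+x. h x \<partial>offer_law lam q \<theta> \<partial>\<mu>)"
    using lawD(3)[OF \<mu>] q_measurable_offer
    by (intro nn_integral_cong) (auto simp: offer_law_def nn_integral_density)
  finally show ?thesis .
qed

lemma prob_space_predictive:
  assumes \<mu>: "law \<mu>"
  shows "prob_space (predictive lam q \<mu>)"
proof
  have "emeasure (predictive lam q \<mu>) (space (predictive lam q \<mu>))
      = (\<integral>\<^sup>+\<theta>. \<integral>\<^sup>+x. 1 \<partial>offer_law lam q \<theta> \<partial>\<mu>)"
    using nn_integral_predictive[OF \<mu>, of "\<lambda>_. 1"] by simp
  also have "\<dots> = (\<integral>\<^sup>+\<theta>. 1 \<partial>\<mu>)"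
    using prob_space.emeasure_space_1[OF q_density] lawD(3)[OF \<mu>]
    by (intro nn_integral_cong) auto
  also have "\<dots> = 1"
    using prob_space.emeasure_space_1[OF lawD(1)[OF \<mu>]] by simp
  finally show "emeasure (predictive lam q \<mu>) (space (predictive lam q \<mu>)) = 1" .
qed

text \<open>
  The bound does not depend on the law of the parameter; this uniformity is what carries the
  bounds on the reservation levels through the backward induction.
\<close>

lemma predictive_mean_bounded:
  obtains C where "0 \<le> C"
    "\<And>\<mu>. law \<mu> \<Longrightarrow> (\<integral>\<^sup>+x. ennreal (max 0 x) \<partial>predictive lam q \<mu>) \<le> ennreal C"
proof -
  let ?S = "SUP \<theta>\<in>\<Theta>. \<integral>\<^sup>+ x. ennreal (max 0 x) \<partial>offer_law lam q \<theta>"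
  have S: "ennreal (enn2real ?S) = ?S" using offers_bounded by simp
  show ?thesis
  proof (rule that[of "enn2real ?S"])
    fix \<mu> assume \<mu>: "law \<mu>"
    have "(\<integral>\<^sup>+x. ennreal (max 0 x) \<partial>predictive lam q \<mu>)
        = (\<integral>\<^sup>+\<theta>. \<integral>\<^sup>+x. ennreal (max 0 x) \<partial>offer_law lam q \<theta> \<partial>\<mu>)"
      by (rule nn_integral_predictive[OF \<mu>]) simp
    also have "\<dots> \<le> (\<integral>\<^sup>+\<theta>. ?S \<partial>\<mu>)"
      using lawD(3)[OF \<mu>] by (intro nn_integral_mono SUP_upper) auto
    also have "\<dots> = ?S"
      using prob_space.emeasure_space_1[OF lawD(1)[OF \<mu>]] by simp
    finally show "(\<integral>\<^sup>+x. ennreal (max 0 x) \<partial>predictive lam q \<mu>) \<le> ennreal (enn2real ?S)"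
      by (simp only: S)
  qed simp
qed

text \<open>
  The offers after which Bayes' formula gives a probability measure. Almost every offer drawn from
  the predictive law of \<open>\<mu>\<close> is of this kind, but an offer drawn from another
  predictive law need not be.
\<close>

definition updatable :: "real measure \<Rightarrow> real set" where
  "updatable \<mu> = {x. 0 < marginal \<mu> x \<and> marginal \<mu> x < \<infinity>}"

lemma AE_updatable:
  assumes \<mu>: "law \<mu>"
  shows "AE x in predictive lam q \<mu>. x \<in> updatable \<mu>"
proof -
  note [measurable] = marginal_measurable[OF \<mu>]
  have "(\<integral>\<^sup>+x. marginal \<mu> x \<partial>lam) = 1"
    using prob_space.emeasure_space_1[OF prob_space_predictive[OF \<mu>]]
    by (simp add: predictive_eq emeasure_density cong: nn_integral_cong)
  then have "AE x in lam. marginal \<mu> x \<noteq> \<infinity>"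
    by (intro nn_integral_PInf_AE) auto
  then show ?thesis
    unfolding predictive_eq
    by (subst AE_density) (auto simp: updatable_def less_top)
qed

lemma bayes_update_density:
  assumes \<nu>: "sets \<nu> = sets (restrict_space borel \<Theta>)" and [measurable]: "f \<in> borel_measurable \<nu>"
  shows "bayes_update q x (density \<nu> f)
    = density \<nu> (\<lambda>\<theta>. f \<theta> * (ennreal (q x \<theta>) * inverse (marginal (density \<nu> f) x)))"
proof -
  note [measurable] = q_measurable_parameter[OF \<nu>]
  show ?thesis
    unfolding bayes_update_def marginal_def[symmetric] divide_ennreal_def
    by (intro density_density_eq) measurable
qed

lemma prob_space_bayes_update:
  assumes \<mu>: "law \<mu>" and x: "x \<in> updatable \<mu>"
  shows "prob_space (bayes_update q x \<mu>)"
proof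
  note [measurable] = q_measurable_parameter[OF lawD(2)[OF \<mu>]]
  have "emeasure (bayes_update q x \<mu>) (space (bayes_update q x \<mu>))
      = (\<integral>\<^sup>+\<theta>. ennreal (q x \<theta>) / marginal \<mu> x \<partial>\<mu>)"
    by (simp add: bayes_update_def marginal_def emeasure_density cong: nn_integral_cong)
  also have "\<dots> = marginal \<mu> x / marginal \<mu> x"
    by (simp add: nn_integral_divide marginal_def)
  also have "\<dots> = 1"
    using x by (intro ennreal_divide_self) (auto simp: updatable_def)
  finally show "emeasure (bayes_update q x \<mu>) (space (bayes_update q x \<mu>)) = 1" .
qed

text \<open>
  The product form of \<open>mtp2\<close> is symmetric in offers and parameters, so a larger offer is a
  likelihood that favours larger parameters.
\<close>

lemma likelihood_cross_le:
  assumes "x \<le> y"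
  shows "cross_le \<Theta> (\<lambda>\<theta>. ennreal (q x \<theta>)) (\<lambda>\<theta>. ennreal (q y \<theta>))"
proof (rule cross_leI)
  fix s t assume st: "s \<in> \<Theta>" "t \<in> \<Theta>" "s \<le> t"
  have "lr_le UNIV (\<lambda>x. q x s) (\<lambda>x. q x t)"
    using mtp2 st by (auto simp: mtp2_def)
  then have "cross_le UNIV (\<lambda>x. ennreal (q x s)) (\<lambda>x. ennreal (q x t))"
    by (rule lr_le_imp_cross_le) (auto intro: q_nonneg st)
  then have "ennreal (q y s) * ennreal (q x t) \<le> ennreal (q x s) * ennreal (q y t)"
    by (rule cross_leD) (auto simp: assms)
  then show "ennreal (q x t) * ennreal (q y s) \<le> ennreal (q x s) * ennreal (q y t)"
    by (simp add: mult.commute)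
qed

text \<open>
  The likelihoods of two offers \<open>x \<le> y\<close>, as functions of the parameter, serve as the second pair
  in \<open>basic_composition\<close>.
\<close>

lemma marginal_cross_le:
  assumes \<nu>: "sets \<nu> = sets (restrict_space borel \<Theta>)"
    and [measurable]: "f \<in> borel_measurable \<nu>" "g \<in> borel_measurable \<nu>"
    and fg: "cross_le \<Theta> f g"
  shows "cross_le UNIV (marginal (density \<nu> f)) (marginal (density \<nu> g))"
proof (rule cross_leI)
  fix x y :: real assume "x \<le> y"
  note [measurable] = q_measurable_parameter[OF \<nu>]
  have "cross_le (space \<nu>) f g"
      "cross_le (space \<nu>) (\<lambda>\<theta>. ennreal (q x \<theta>)) (\<lambda>\<theta>. ennreal (q y \<theta>))"
    using fg likelihood_cross_le[OF \<open>x \<le> y\<close>] by (auto simp: space_parameter[OF \<nu>])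
  then show "marginal (density \<nu> f) y * marginal (density \<nu> g) x
      \<le> marginal (density \<nu> f) x * marginal (density \<nu> g) y"
    using basic_composition[of f \<nu> g "\<lambda>\<theta>. ennreal (q x \<theta>)" "\<lambda>\<theta>. ennreal (q y \<theta>)"]
    by (simp add: marginal_def nn_integral_density mult.commute)
qed

end

section \<open>Reservation levels\<close>

locale house_selling = offer_model \<Theta> lam q
  for \<Theta> :: "real set" and lam :: "real measure" and q :: "real \<Rightarrow> real \<Rightarrow> real" +
  fixes U :: "real \<Rightarrow> real" and c :: real and N :: nat and J :: "'i set"
    and \<mu>h :: "'i \<Rightarrow> real measure" and \<Phi>h :: "real \<Rightarrow> 'i \<Rightarrow> 'i" and \<nu> :: "real measure"
  assumes c_nonneg: "0 \<le> c"
    and U: "strict_mono U" "concave_on UNIV U"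
    and law_posterior: "\<And>i. i \<in> J \<Longrightarrow> law (\<mu>h i)"
    and update_closed: "\<And>x i. i \<in> J \<Longrightarrow> \<Phi>h x i \<in> J"
    and update_consistent:
      "\<And>x i. i \<in> J \<Longrightarrow> prob_space (bayes_update q x (\<mu>h i)) \<Longrightarrow> \<mu>h (\<Phi>h x i) = bayes_update q x (\<mu>h i)"
    and sets_nu: "sets \<nu> = sets (restrict_space borel \<Theta>)"
begin

abbreviation level :: "nat \<Rightarrow> 'i \<Rightarrow> ereal" where
  "level \<equiv> reservation U c N (\<lambda>j. predictive lam q (\<mu>h j)) \<Phi>h"

text \<open>
  Bayes' rule determines the law at the updated information, but its density only up to null sets.
  The order asserted by \<open>info_le\<close> for one given density is therefore replaced by the existence of
  ordered versions, which is a property of the laws and can be used in an induction.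
\<close>

definition posterior_le :: "'i \<Rightarrow> 'i \<Rightarrow> bool" where
  "posterior_le i j \<longleftrightarrow> (\<exists>f g. f \<in> borel_measurable \<nu> \<and> g \<in> borel_measurable \<nu>
     \<and> \<mu>h i = density \<nu> f \<and> \<mu>h j = density \<nu> g \<and> cross_le \<Theta> f g)"

lemma posterior_le_update:
  assumes ij: "i \<in> J" "j \<in> J" "posterior_le i j"
    and x: "x \<in> updatable (\<mu>h i)" and y: "y \<in> updatable (\<mu>h j)" and "x \<le> y"
  shows "posterior_le (\<Phi>h x i) (\<Phi>h y j)"
proof -
  obtain f g where [measurable]: "f \<in> borel_measurable \<nu>" "g \<in> borel_measurable \<nu>"
    and f: "\<mu>h i = density \<nu> f" and g: "\<mu>h j = density \<nu> g" and fg: "cross_le \<Theta> f g"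
    using ij(3) by (auto simp: posterior_le_def)
  note [measurable] = q_measurable_parameter[OF sets_nu]
  define f' where "f' \<theta> = f \<theta> * (ennreal (q x \<theta>) * inverse (marginal (\<mu>h i) x))" for \<theta>
  define g' where "g' \<theta> = g \<theta> * (ennreal (q y \<theta>) * inverse (marginal (\<mu>h j) y))" for \<theta>
  have "\<mu>h (\<Phi>h x i) = bayes_update q x (\<mu>h i)" "\<mu>h (\<Phi>h y j) = bayes_update q y (\<mu>h j)"
    by (intro update_consistent prob_space_bayes_update law_posterior ij x y)+
  then have "\<mu>h (\<Phi>h x i) = density \<nu> f'" "\<mu>h (\<Phi>h y j) = density \<nu> g'"
    using bayes_update_density[OF sets_nu, of f x] bayes_update_density[OF sets_nu, of g y]
    by (simp_all add: f g f'_def[abs_def] g'_def[abs_def])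
  moreover have "cross_le \<Theta> f' g'"
    unfolding f'_def g'_def
    by (intro cross_le_mult fg likelihood_cross_le \<open>x \<le> y\<close> cross_le_const)
  moreover have "f' \<in> borel_measurable \<nu>" "g' \<in> borel_measurable \<nu>"
    unfolding f'_def[abs_def] g'_def[abs_def] by measurable
  ultimately show ?thesis
    unfolding posterior_le_def by blast
qed

lemma ext_integral_predictive_mono:
  assumes ij: "i \<in> J" "j \<in> J" "posterior_le i j"
    and FG: "\<And>x y. x \<in> updatable (\<mu>h i) \<Longrightarrow> y \<in> updatable (\<mu>h j) \<Longrightarrow> x \<le> y \<Longrightarrow> F x \<le> G y"
  shows "ext_integral (predictive lam q (\<mu>h i)) F \<le> ext_integral (predictive lam q (\<mu>h j)) G"
proof -
  have "cross_le UNIV (marginal (\<mu>h i)) (marginal (\<mu>h j))"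
    using ij(3) marginal_cross_le[OF sets_nu] by (auto simp: posterior_le_def)
  moreover note laws = ij(1,2)[THEN law_posterior]
  ultimately show ?thesis
    using laws[THEN prob_space_predictive] laws[THEN AE_updatable] laws[THEN marginal_measurable]
    unfolding predictive_eq by (intro ext_integral_mono_cross_le[OF sets_lam]) (auto intro: FG)
qed

text \<open>
  The amount that is available one period after time \<open>n\<close> if the next offer is \<open>x\<close>. In the last
  period there is nothing to wait for, so it is the offer itself; with this convention the two
  cases of \<open>reservation\<close> become the single recursion \<open>level_eq\<close>.
\<close>

definition payoff :: "nat \<Rightarrow> 'i \<Rightarrow> real \<Rightarrow> real" where
  "payoff n i x =
     (if Suc n < N then real_of_ereal (max (ereal x) (level (Suc n) (\<Phi>h x i))) else x)"

lemma level_eq: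
  assumes "n < N"
  shows "level n i = util_inv U c n
    (ext_integral (predictive lam q (\<mu>h i)) (\<lambda>x. util U c (Suc n) (payoff n i x)))"
proof (cases "Suc n < N")
  case True
  then show ?thesis
    by (subst reservation.simps) (simp add: payoff_def)
next
  case False
  with assms have "Suc n = N" "N - 1 = n" by auto
  then show ?thesis
    by (subst reservation.simps) (simp add: payoff_def)
qed

text \<open>
  Backward induction: a bound \<open>U m\<close> at time \<open>n + 1\<close> bounds the levels there by a constant, so the
  payoff at time \<open>n\<close> is at most the positive part of the offer plus a constant, and Jensen's
  inequality with the uniform bound on the mean offers gives a bound at time \<open>n\<close>.
\<close>

lemma expected_utility_bounded:
  assumes "n < N"
  shows "\<exists>m. \<forall>i\<in>J. ext_integral (predictive lam q (\<mu>h i)) (\<lambda>x. util U c (Suc n) (payoff n i x))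
    \<le> ereal (U m)"
  using assms
proof (induction "N - n" arbitrary: n)
  case (Suc k)
  obtain C where C: "0 \<le> C"
    "\<And>\<mu>. law \<mu> \<Longrightarrow> (\<integral>\<^sup>+x. ennreal (max 0 x) \<partial>predictive lam q \<mu>) \<le> ennreal C"
    using predictive_mean_bounded by blast
  have "\<exists>B\<ge>0. \<forall>i\<in>J. \<forall>x. payoff n i x \<le> max 0 x + B"
  proof (cases "Suc n < N")
    case True
    with Suc.hyps have "k = N - Suc n" by simp
    with Suc.hyps(1)[of "Suc n"] True obtain m where
      m: "\<And>i. i \<in> J \<Longrightarrow> ext_integral (predictive lam q (\<mu>h i))
        (\<lambda>x. util U c (Suc (Suc n)) (payoff (Suc n) i x)) \<le> ereal (U m)"
      by blast
    define B where "B = real (Suc n) * c + m"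
    have "payoff n i x \<le> max 0 x + \<bar>B\<bar>" if "i \<in> J" for i x
    proof -
      have "level (Suc n) (\<Phi>h x i) \<le> ereal B"
        unfolding level_eq[OF True] B_def
        by (rule util_inv_mono_bounded(2)[OF U order_refl m]) (rule update_closed[OF that])
      then show ?thesis
        using True by (cases "level (Suc n) (\<Phi>h x i)") (auto simp: payoff_def max_def)
    qed
    then show ?thesis by (intro exI[of _ "\<bar>B\<bar>"]) auto
  next
    case False
    then show ?thesis by (intro exI[of _ 0]) (simp add: payoff_def)
  qed
  then obtain B where B: "\<And>i x. i \<in> J \<Longrightarrow> payoff n i x \<le> max 0 x + B" by blast
  have "ext_integral (predictive lam q (\<mu>h i)) (\<lambda>x. util U c (Suc n) (payoff n i x))
      \<le> ereal (U (C + B))" if "i \<in> J" for i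
    unfolding util_def
  proof (rule ext_integral_concave_le[OF U])
    show "payoff n i x - real (Suc n) * c \<le> max 0 x + B" for x
      using B[OF that, of x] mult_nonneg_nonneg[of "real (Suc n)" c] c_nonneg by linarith
  qed (use law_posterior[OF that] C prob_space_predictive sets_lam in
      \<open>auto simp: predictive_eq\<close>)
  then show ?case by blast
qed simp

text \<open>
  Finiteness from above is used where the maximum of an offer and a level is read as a real
  number, because \<open>real_of_ereal\<close> sends \<open>\<infinity>\<close> to \<open>0\<close>.
\<close>

lemma level_finite:
  assumes "n < N" "i \<in> J"
  shows "level n i < \<infinity>"
proof -
  obtain m where "\<forall>i\<in>J. ext_integral (predictive lam q (\<mu>h i))
      (\<lambda>x. util U c (Suc n) (payoff n i x)) \<le> ereal (U m)"
    using expected_utility_bounded[OF assms(1)] by blast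
  then have "level n i \<le> ereal (real n * c + m)"
    unfolding level_eq[OF assms(1)] using assms(2)
    by (intro util_inv_mono_bounded(2)[OF U order_refl]) blast
  then show ?thesis by (rule le_less_trans) simp
qed

text \<open>
  For possible offers \<open>x \<le> y\<close> under \<open>i\<close> and \<open>j\<close>, the updated information is again
  ordered, so the induction hypothesis orders the levels after \<open>x\<close> and \<open>y\<close>. This makes the payoff
  increasing in offer and information together, as stochastic dominance requires.
\<close>

lemma level_mono:
  assumes "n < N" "i \<in> J" "j \<in> J" "posterior_le i j"
  shows "level n i \<le> level n j"
  using assms
proof (induction "N - n" arbitrary: n i j)
  case (Suc k)
  obtain m where m: "\<forall>i\<in>J. ext_integral (predictive lam q (\<mu>h i))
      (\<lambda>x. util U c (Suc n) (payoff n i x)) \<le> ereal (U m)"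
    using expected_utility_bounded[OF Suc.prems(1)] by blast
  have payoff: "payoff n i x \<le> payoff n j y"
    if x: "x \<in> updatable (\<mu>h i)" and y: "y \<in> updatable (\<mu>h j)" and "x \<le> y" for x y
  proof (cases "Suc n < N")
    case True
    have "level (Suc n) (\<Phi>h x i) \<le> level (Suc n) (\<Phi>h y j)"
      using Suc.hyps True Suc.prems that
      by (intro Suc.hyps(1) posterior_le_update update_closed) auto
    moreover have "level (Suc n) (\<Phi>h y j) < \<infinity>"
      using True Suc.prems by (intro level_finite update_closed)
    ultimately show ?thesis
      using True \<open>x \<le> y\<close>
      by (cases "level (Suc n) (\<Phi>h x i)"; cases "level (Suc n) (\<Phi>h y j)")
        (auto simp: payoff_def max_def)
  next
    case False
    with \<open>x \<le> y\<close> show ?thesis by (simp add: payoff_def)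
  qed
  show ?case
    unfolding level_eq[OF Suc.prems(1)]
  proof (rule util_inv_mono_bounded(1)[OF U])
    show "ext_integral (predictive lam q (\<mu>h i)) (\<lambda>x. util U c (Suc n) (payoff n i x))
        \<le> ext_integral (predictive lam q (\<mu>h j)) (\<lambda>x. util U c (Suc n) (payoff n j x))"
      using Suc.prems U(1)
      by (intro ext_integral_predictive_mono)
        (auto simp: util_def strict_mono_less_eq payoff)
  qed (use m Suc.prems in blast)
qed simp

end

theorem theorem4p4:
  fixes \<Theta> :: "real set"
    and lam :: "real measure"
    and q :: "real \<Rightarrow> real \<Rightarrow> real"
    and Q0 :: "real measure"
    and c :: real
    and N :: nat
    and U :: "real \<Rightarrow> real"
    and I :: "'i measure"
    and t :: "nat \<Rightarrow> (nat \<Rightarrow> real) \<Rightarrow> 'i"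
    and \<mu>h :: "'i \<Rightarrow> real measure"
    and \<Phi>h :: "real \<Rightarrow> 'i \<Rightarrow> 'i"
    and \<nu> :: "real measure"
    and p :: "real \<Rightarrow> 'i \<Rightarrow> real"
  assumes lam: "sigma_finite_measure lam" "sets lam = sets borel"
    and q_measurable:
      "(\<lambda>(x, \<theta>). q x \<theta>) \<in> borel_measurable (borel \<Otimes>\<^sub>M restrict_space borel \<Theta>)"
    and q_nonneg: "\<And>x \<theta>. \<theta> \<in> \<Theta> \<Longrightarrow> 0 \<le> q x \<theta>"
    and q_density: "\<And>\<theta>. \<theta> \<in> \<Theta> \<Longrightarrow> prob_space (offer_law lam q \<theta>)"
    and offers_bounded:
      "(SUP \<theta>\<in>\<Theta>. \<integral>\<^sup>+ x. ennreal (max 0 x) \<partial>offer_law lam q \<theta>) < \<infinity>"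
    and prior: "Q0 \<in> space (prob_algebra (restrict_space borel \<Theta>))"
    and c_pos: "0 < c"
    and U: "strict_mono U" "concave_on UNIV U"
    and t_measurable: "\<And>n. n \<le> N \<Longrightarrow> t n \<in> history n \<rightarrow>\<^sub>M I"
    and kernel: "\<mu>h \<in> I \<rightarrow>\<^sub>M prob_algebra (restrict_space borel \<Theta>)"
    and sufficient:
      "\<And>n h. n \<le> N \<Longrightarrow> h \<in> space (history n) \<Longrightarrow> prob_space (bayes_filter q Q0 n h)
        \<Longrightarrow> bayes_filter q Q0 n h = \<mu>h (t n h)"
    and update_measurable: "(\<lambda>(x, i). \<Phi>h x i) \<in> borel \<Otimes>\<^sub>M I \<rightarrow>\<^sub>M I"
    and t_Suc:
      "\<And>n h. n < N \<Longrightarrow> h \<in> space (history (Suc n))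
        \<Longrightarrow> t (Suc n) h = \<Phi>h (h (Suc n)) (t n (restrict h {..n}))"
    and update_consistent:
      "\<And>x i. i \<in> space I \<Longrightarrow> prob_space (bayes_update q x (\<mu>h i))
        \<Longrightarrow> \<mu>h (\<Phi>h x i) = bayes_update q x (\<mu>h i)"
    and nu: "sigma_finite_measure \<nu>" "sets \<nu> = sets (restrict_space borel \<Theta>)"
    and p_measurable: "\<And>i. i \<in> space I \<Longrightarrow> (\<lambda>\<theta>. p \<theta> i) \<in> borel_measurable \<nu>"
    and p_nonneg: "\<And>\<theta> i. i \<in> space I \<Longrightarrow> \<theta> \<in> \<Theta> \<Longrightarrow> 0 \<le> p \<theta> i"
    and p_density: "\<And>i. i \<in> space I \<Longrightarrow> \<mu>h i = density \<nu> (\<lambda>\<theta>. ennreal (p \<theta> i))"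
    and mtp2: "mtp2 \<Theta> q"
  shows "\<forall>n<N. \<forall>i\<in>space I. \<forall>i'\<in>space I. info_le \<Theta> p i i' \<longrightarrow>
    reservation U c N (\<lambda>j. predictive lam q (\<mu>h j)) \<Phi>h n i
      \<le> reservation U c N (\<lambda>j. predictive lam q (\<mu>h j)) \<Phi>h n i'"
proof -
  have closed: "\<Phi>h x i \<in> space I" if "i \<in> space I" for x i
    using measurable_space[OF update_measurable, of "(x, i)"] that
    by (simp add: space_pair_measure)
  have law: "\<mu>h i \<in> space (prob_algebra (restrict_space borel \<Theta>))" if "i \<in> space I" for i
    by (rule measurable_space[OF kernel that])
  interpret house_selling \<Theta> lam q U c N "space I" \<mu>h \<Phi>h \<nu>
    by (intro house_selling.intro offer_model.intro house_selling_axioms.intro)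
      (fact lam q_measurable q_nonneg q_density offers_bounded mtp2
      less_imp_le[OF c_pos] U law closed update_consistent nu(2))+
  have "posterior_le i i'" if i: "i \<in> space I" "i' \<in> space I" and le: "info_le \<Theta> p i i'" for i i'
    unfolding posterior_le_def
  proof (intro exI conjI)
    show "cross_le \<Theta> (\<lambda>\<theta>. ennreal (p \<theta> i)) (\<lambda>\<theta>. ennreal (p \<theta> i'))"
      using le unfolding info_le_def by (rule lr_le_imp_cross_le) (auto intro: p_nonneg i)
  qed (use p_measurable p_density i in auto)
  then show ?thesis
    by (intro allI impI ballI level_mono)
qed

end
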